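(* Let $S$ be a maximal embedding dimension numerical semigroup of multiplicity $m$. If $m\ge3$ is prime, then $S$ is bland.
   Context: A numerical semigroup is a set $S=\langle n_1,\ldots,n_k\rangle=\{z_1n_1+\cdots+z_kn_k : z_i\in\mathbb Z_{\ge0}\}$, where $n_1,\ldots,n_k$ are its minimal generators. Its multiplicity $\mathsf m(S)$ is its smallest positive element and its embedding dimension $\mathsf e(S)$ is its number of minimal generators. $S$ has maximal embedding dimension (MED) if $\mathsf e(S)=\mathsf m(S)$; in this case, with $m=\mathsf m(S)$, write $S=\langle m,n_1,\ldots,n_{m-1}\rangle$ with $n_i\equiv i\bmod m$ for each $i$, these being the minimal generators. For $n\in S$, $\mathsf L_S(n)$ is the set of all lengths $z_1+\cdots+z_k$ of factorizations of $n$, i.e. of expressions of $n$ as a nonnegative integer combination of the minimal generators with coefficients $z_1,\ldots,z_k$. Writing $\mathsf L_S(n)=\{\ell_1<\cdots<\ell_r\}$, put $\Delta_S(n)=\{\ell_i-\ell_{i-1}:2\le i\le r\}$ and $\Delta(S)=\bigcup_{n\in S}\Delta_S(n)$. For $n\in S$ with $|\mathsf L_S(n)|\ge2$, $\operatorname{LD}_S(n)=\frac{|\mathsf L_S(n)|-1}{\max\mathsf L_S(n)-\min\mathsf L_S(n)}$, and $\operatorname{LD}(S)=\inf\{\operatorname{LD}_S(n): n\in S,\ |\mathsf L_S(n)|\ge2\}$. One always has $\operatorname{LD}(S)\ge 1/\max\Delta(S)$; $S$ is tasty if $\operatorname{LD}(S)>1/\max\Delta(S)$ and bland otherwise. *)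

theory Defs
  imports Complex_Main "HOL-Computational_Algebra.Primes"
begin

text \<open>
  The submonoid of the natural numbers generated by a finite set, in terms of coefficient
  functions; the values of a coefficient function \<open>z\<close> outside \<open>G\<close> play no role.
\<close>

definition generated :: "nat set \<Rightarrow> nat set" where
  "generated G = {n. \<exists>z :: nat \<Rightarrow> nat. n = (\<Sum>g\<in>G. z g * g)}"

text \<open>
  Finiteness of the complement (coprime generators) is not part of this definition.  It is
  automatic for maximal embedding dimension: two distinct minimal generators are never congruent
  modulo the multiplicity, so if there are as many minimal generators as residue classes, every
  residue class is met.
\<close>

definition numerical_semigroup :: "nat set \<Rightarrow> bool" where
  "numerical_semigroup S \<longleftrightarrow> (\<exists>G. finite G \<and> S = generated G)"

definition is_min_generating_set :: "nat set \<Rightarrow> nat set \<Rightarrow> bool" where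
  "is_min_generating_set S G \<longleftrightarrow>
     finite G \<and> generated G = S \<and> (\<forall>H. H \<subset> G \<longrightarrow> generated H \<noteq> S)"

text \<open>Well-defined by lemma \<open>ex1_min_generating_set\<close> below.\<close>

definition min_generators :: "nat set \<Rightarrow> nat set" where
  "min_generators S = (THE G. is_min_generating_set S G)"

lemma generated_mem: "finite G \<Longrightarrow> g \<in> G \<Longrightarrow> g \<in> generated G"
  unfolding generated_def
  by (auto intro!: exI[of _ "\<lambda>h. if h = g then 1 else 0"] simp: if_distrib[of "\<lambda>x. x * _"] cong: if_cong)

lemma generated_add: "x \<in> generated G \<Longrightarrow> y \<in> generated G \<Longrightarrow> x + y \<in> generated G"
proof -
  assume "x \<in> generated G" "y \<in> generated G"
  then obtain z w where "x = (\<Sum>g\<in>G. z g * g)" "y = (\<Sum>g\<in>G. w g * g)"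
    unfolding generated_def by blast
  hence "x + y = (\<Sum>g\<in>G. (z g + w g) * g)"
    by (simp add: sum.distrib algebra_simps)
  thus ?thesis unfolding generated_def by (auto intro!: exI[of _ "\<lambda>g. z g + w g"])
qed

lemma generated_zero: "0 \<in> generated G"
  unfolding generated_def by (auto intro!: exI[of _ "\<lambda>_. 0"])

lemma ex1_min_generating_set:
  assumes "numerical_semigroup S"
  shows "\<exists>!G. is_min_generating_set S G"
proof -
  define A where "A = {a \<in> S. a > 0 \<and> \<not> (\<exists>x\<in>S. \<exists>y\<in>S. x > 0 \<and> y > 0 \<and> a = x + y)}"
  have sub: "A \<subseteq> G" if G: "finite G" "generated G = S" for G
  proof
    fix a assume a: "a \<in> A"
    then obtain z where z: "a = (\<Sum>g\<in>G. z g * g)"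
      using G unfolding A_def generated_def by blast
    from a have "(\<Sum>g\<in>G. z g * g) \<noteq> 0" using z A_def by auto
    then obtain h where h: "h \<in> G" "z h * h \<noteq> 0" by (meson sum.neutral)
    define w where "w = z(h := z h - 1)"
    have "a = z h * h + (\<Sum>g\<in>G - {h}. z g * g)" using z h G by (simp add: sum.remove)
    also have "z h * h = h + w h * h" using h by (cases "z h") (auto simp: w_def)
    also have "(\<Sum>g\<in>G - {h}. z g * g) = (\<Sum>g\<in>G - {h}. w g * g)"
      by (rule sum.cong) (auto simp: w_def)
    finally have "a = h + (\<Sum>g\<in>G. w g * g)" using h G by (simp add: sum.remove)
    moreover have "h \<in> S" using generated_mem G h by blast
    moreover have "(\<Sum>g\<in>G. w g * g) \<in> S" using G unfolding generated_def by blast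
    moreover have "h > 0" using h by (cases h) auto
    ultimately have "a = h" using a unfolding A_def by fastforce
    thus "a \<in> G" using h by simp
  qed
  obtain G0 where G0: "finite G0" "generated G0 = S"
    using assms unfolding numerical_semigroup_def by blast
  have finA: "finite A" using sub[OF G0] G0 finite_subset by blast
  have "n \<in> generated A" if "n \<in> S" for n
    using that
  proof (induction n rule: less_induct)
    case (less n)
    show ?case
    proof (cases "n = 0 \<or> n \<in> A")
      case True
      thus ?thesis using generated_zero generated_mem finA by blast
    next
      case False
      then obtain x y where "x \<in> S" "y \<in> S" "x > 0" "y > 0" "n = x + y"
        using less.prems unfolding A_def by auto
      thus ?thesis using less.IH[of x] less.IH[of y] generated_add by simp
    qed
  qed
  moreover have "generated A \<subseteq> S"
  proof
    fix n assume "n \<in> generated A"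
    then obtain z where "n = (\<Sum>a\<in>A. z a * a)" unfolding generated_def by blast
    also have "\<dots> = (\<Sum>g\<in>G0. (if g \<in> A then z g else 0) * g)"
      using sub[OF G0] G0(1) by (intro sum.mono_neutral_cong_left) auto
    finally have "n = (\<Sum>g\<in>G0. (if g \<in> A then z g else 0) * g)" .
    thus "n \<in> S" unfolding G0(2)[symmetric] generated_def
      by (intro CollectI exI[of _ "\<lambda>g. if g \<in> A then z g else 0"])
  qed
  ultimately have genA: "generated A = S" by blast
  show ?thesis
  proof (rule ex1I[of _ A])
    show "is_min_generating_set S A"
      unfolding is_min_generating_set_def
    proof (intro conjI allI impI finA genA)
      fix H assume H: "H \<subset> A"
      hence "finite H" using finA finite_subset by blast
      thus "generated H \<noteq> S" using sub[of H] H by blast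
    qed
    show "G = A" if "is_min_generating_set S G" for G
      using that sub[of G] genA unfolding is_min_generating_set_def by blast
  qed
qed

definition semigroup_multiplicity :: "nat set \<Rightarrow> nat" where
  "semigroup_multiplicity S = (LEAST n. n \<in> S \<and> n > 0)"

definition embedding_dimension :: "nat set \<Rightarrow> nat" where
  "embedding_dimension S = card (min_generators S)"

definition max_embedding_dimension :: "nat set \<Rightarrow> bool" where
  "max_embedding_dimension S \<longleftrightarrow> embedding_dimension S = semigroup_multiplicity S"

definition length_set :: "nat set \<Rightarrow> nat \<Rightarrow> nat set" where
  "length_set S n =
     {l. \<exists>z :: nat \<Rightarrow> nat. n = (\<Sum>g\<in>min_generators S. z g * g) \<and> l = (\<Sum>g\<in>min_generators S. z g)}"

text \<open>
  Length sets are finite, since \<open>0\<close> is not a minimal generator; hence \<open>sorted_list_of_set\<close>,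
  \<open>card\<close>, \<open>Max\<close> and \<open>Min\<close> below have their intended meaning.
\<close>

definition delta_set_elem :: "nat set \<Rightarrow> nat \<Rightarrow> nat set" where
  "delta_set_elem S n =
     (let ls = sorted_list_of_set (length_set S n)
      in {ls ! Suc i - ls ! i | i. Suc i < length ls})"

definition delta_set :: "nat set \<Rightarrow> nat set" where
  "delta_set S = (\<Union>n\<in>S. delta_set_elem S n)"

definition length_density_elem :: "nat set \<Rightarrow> nat \<Rightarrow> real" where
  "length_density_elem S n =
     (real (card (length_set S n)) - 1) /
     (real (Max (length_set S n)) - real (Min (length_set S n)))"

definition length_density :: "nat set \<Rightarrow> real" where
  "length_density S = Inf {length_density_elem S n | n. n \<in> S \<and> card (length_set S n) \<ge> 2}"

text \<open>
  The delta set of a numerical semigroup is finite; it is nonempty, as is the set in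
  \<open>length_density\<close>, exactly when there are at least two minimal generators.
\<close>

definition tasty :: "nat set \<Rightarrow> bool" where
  "tasty S \<longleftrightarrow> length_density S > 1 / real (Max (delta_set S))"

definition bland :: "nat set \<Rightarrow> bool" where
  "bland S \<longleftrightarrow> \<not> tasty S"

end

theory Submission
  imports Defs "HOL-Library.Multiset"
begin

text \<open>
  Write \<open>N r\<close> for the minimal generator congruent to \<open>r\<close> modulo \<open>m\<close>, so \<open>N 0 = m\<close>.  Minimality
  gives \<open>N (r + s) + m \<le> N r + N s\<close>.  Choose \<open>a\<close> not divisible by \<open>m\<close> with
  \<open>N a + N (- a) = (D + 2) m\<close> as small as possible.  By this minimality the element \<open>N a + N (- a)\<close>
  only has the lengths \<open>2\<close> and \<open>D + 2\<close>, so its length density is \<open>1 / D\<close>.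

  No gap exceeds \<open>D\<close>: in a factorization that is not of maximal length one can trade pairs
  \<open>g, h\<close> of generators other than \<open>m\<close> for \<open>N (g + h), m\<close>, keeping the length, until some pair \<open>g, h\<close> satisfies
  \<open>g + h > N (g + h) + m\<close>.  Along the walk \<open>s t = N (g + t a) + N (h - t a)\<close> consecutive values differ
  by at most \<open>D m\<close>, and since \<open>m\<close> is prime the walk reaches \<open>m + N (g + h) < s 0\<close>.  The first value
  below \<open>s 0\<close> is thus \<open>s 0 - c m\<close> with \<open>0 < c \<le> D\<close>, which lengthens the factorization by \<open>c\<close>.
\<close>

section \<open>Factorizations as multisets of generators\<close>

lemma sum_mset_as_sum_count:
  fixes F :: "nat multiset"
  assumes "finite G" "set_mset F \<subseteq> G"
  shows "sum_mset F = (\<Sum>g\<in>G. count F g * g)"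
  using assms(2)
proof (induction F)
  case (add x F)
  have "(\<Sum>g\<in>G. count (add_mset x F) g * g) = (\<Sum>g\<in>G. count F g * g + (if g = x then g else 0))"
    by (rule sum.cong) auto
  also have "\<dots> = sum_mset F + x"
    using add assms(1) by (simp add: sum.distrib)
  finally show ?case by simp
qed simp

lemma size_as_sum_count:
  assumes "finite G" "set_mset F \<subseteq> G"
  shows "size F = (\<Sum>g\<in>G. count F g)"
  unfolding size_multiset_overloaded_eq
  using assms by (intro sum.mono_neutral_left) (auto simp: not_in_iff)

text \<open>Coefficient functions are arbitrary outside \<open>G\<close>; cutting them off there
  turns them into multisets, on which induction and exchange of generators are easy.\<close>

lemma ex_mset_count:
  assumes "finite G"
  obtains F where "set_mset F \<subseteq> G" "\<And>g. g \<in> G \<Longrightarrow> count F g = z g"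
proof
  let ?F = "\<Sum>g\<in>G. replicate_mset (z g) g"
  have c: "count ?F g = (if g \<in> G then z g else 0)" for g
    using assms by (simp add: count_sum)
  then show "set_mset ?F \<subseteq> G"
    by (metis count_eq_zero_iff subsetI)
  show "count ?F g = z g" if "g \<in> G" for g
    using c that by simp
qed

lemma generated_iff_mset:
  assumes "finite G"
  shows "n \<in> generated G \<longleftrightarrow> (\<exists>F. set_mset F \<subseteq> G \<and> sum_mset F = n)"
proof
  assume "n \<in> generated G"
  then obtain z where z: "n = (\<Sum>g\<in>G. z g * g)" unfolding generated_def by blast
  obtain F where F: "set_mset F \<subseteq> G" "\<And>g. g \<in> G \<Longrightarrow> count F g = z g"
    using ex_mset_count[OF assms, of z] by blast
  have "sum_mset F = n" using sum_mset_as_sum_count[OF assms F(1)] F(2) z by simp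
  then show "\<exists>F. set_mset F \<subseteq> G \<and> sum_mset F = n" using F(1) by blast
next
  assume "\<exists>F. set_mset F \<subseteq> G \<and> sum_mset F = n"
  then show "n \<in> generated G"
    using sum_mset_as_sum_count[OF assms] unfolding generated_def by blast
qed

lemma length_set_iff_mset:
  assumes "finite (min_generators S)"
  shows "l \<in> length_set S n \<longleftrightarrow>
    (\<exists>F. set_mset F \<subseteq> min_generators S \<and> sum_mset F = n \<and> size F = l)"
proof
  assume "l \<in> length_set S n"
  then obtain z where z: "n = (\<Sum>g\<in>min_generators S. z g * g)" "l = (\<Sum>g\<in>min_generators S. z g)"
    unfolding length_set_def by blast
  obtain F where F: "set_mset F \<subseteq> min_generators S"
    "\<And>g. g \<in> min_generators S \<Longrightarrow> count F g = z g"
    using ex_mset_count[OF assms, of z] by blast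
  have "sum_mset F = n" "size F = l"
    using sum_mset_as_sum_count[OF assms F(1)] size_as_sum_count[OF assms F(1)] F(2) z by simp_all
  then show "\<exists>F. set_mset F \<subseteq> min_generators S \<and> sum_mset F = n \<and> size F = l"
    using F(1) by blast
next
  assume "\<exists>F. set_mset F \<subseteq> min_generators S \<and> sum_mset F = n \<and> size F = l"
  then show "l \<in> length_set S n"
    using sum_mset_as_sum_count[OF assms] size_as_sum_count[OF assms]
    unfolding length_set_def by blast
qed

section \<open>Irreducibility and positivity of minimal generators\<close>

lemma is_min_generating_set_irreducible:
  assumes G: "is_min_generating_set S G" and g: "g \<in> G"
    and x: "x \<in> S" "x > 0" and y: "y \<in> S" "y > 0"
  shows "g \<noteq> x + y"
proof
  assume eq: "g = x + y"
  let ?H = "G - {g}"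
  have fin: "finite G" and gen: "generated G = S" and min: "\<And>H. H \<subset> G \<Longrightarrow> generated H \<noteq> S"
    using G unfolding is_min_generating_set_def by auto
  have finH: "finite ?H" using fin by simp
  \<comment> \<open>A factorization of an element below \<open>g\<close> cannot use
    \<open>g\<close>. Applied to both summands, this makes \<open>g\<close> itself
    redundant.\<close>
  have small: "u \<in> generated ?H" if u: "u \<in> S" "u < g" for u
  proof -
    obtain F where F: "set_mset F \<subseteq> G" "sum_mset F = u"
      using u gen generated_iff_mset[OF fin] by blast
    have "g \<notin># F"
      using F(2) u(2) sum_mset.remove[of g F] by auto
    then have "set_mset F \<subseteq> ?H" using F(1) by blast
    then show ?thesis using F(2) generated_iff_mset[OF finH] by blast
  qed
  have "x < g" "y < g" using eq x y by linarith+
  then have "x + y \<in> generated ?H" by (intro generated_add small x(1) y(1))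
  then have gH: "g \<in> generated ?H" by (simp only: eq)
  \<comment> \<open>Each occurrence of \<open>g\<close> can now be replaced, so \<open>?H\<close>
    generates all of \<open>S\<close>, against minimality.\<close>
  have "sum_mset F \<in> generated ?H" if "set_mset F \<subseteq> G" for F
    using that
  proof (induction F)
    case (add v F)
    then have "v \<in> generated ?H" using gH generated_mem[OF finH, of v] by auto
    then show ?case using add generated_add[of v ?H "sum_mset F"] by simp
  qed (simp add: generated_zero)
  then have "S \<subseteq> generated ?H"
    using gen generated_iff_mset[OF fin] by (metis subsetI)
  moreover have "generated ?H \<subseteq> S"
  proof
    fix n assume "n \<in> generated ?H"
    then obtain F where F: "set_mset F \<subseteq> ?H" "sum_mset F = n"
      using generated_iff_mset[OF finH, of n] by auto
    then have "set_mset F \<subseteq> G" by auto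
    then show "n \<in> S" using F(2) gen generated_iff_mset[OF fin, of n] by auto
  qed
  moreover have "?H \<subset> G" using g by auto
  ultimately show False using min by (metis subset_antisym)
qed

lemma is_min_generating_set_pos:
  assumes G: "is_min_generating_set S G" and g: "g \<in> G"
  shows "g > 0"
proof (rule ccontr)
  assume "\<not> g > 0"
  then have g0: "g = 0" by simp
  have fin: "finite G" and gen: "generated G = S" and min: "\<And>H. H \<subset> G \<Longrightarrow> generated H \<noteq> S"
    using G unfolding is_min_generating_set_def by auto
  have "(\<Sum>h\<in>G. z h * h) = (\<Sum>h\<in>G - {g}. z h * h)" for z
    using fin g g0 by (simp add: sum.remove)
  then have "generated (G - {g}) = generated G" unfolding generated_def by simp
  then show False using min[of "G - {g}"] g gen by blast
qed

section \<open>Generators indexed by residues, and the maximal length\<close>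

locale med_generators =
  fixes G :: "nat set" and m :: nat and N :: "nat \<Rightarrow> nat"
  assumes m_pos: "m > 0"
    and N_in: "N r \<in> G"
    and N_mod: "N r mod m = r mod m"
    and N_cong: "r mod m = s mod m \<Longrightarrow> N r = N s"
    and N_gen: "g \<in> G \<Longrightarrow> N g = g"
    and N_zero: "N 0 = m"
    and N_add: "N (r + s) + m \<le> N r + N s"
    and N_gt: "r mod m \<noteq> 0 \<Longrightarrow> N r > m"
begin

definition facts_of :: "nat \<Rightarrow> nat multiset set" where
  "facts_of n = {F. set_mset F \<subseteq> G \<and> sum_mset F = n}"

lemma m_in: "m \<in> G"
  using N_in[of 0] N_zero by simp

lemma gen_mod_zero: "g \<in> G \<Longrightarrow> g mod m = 0 \<Longrightarrow> g = m"
  by (metis N_cong N_gen N_zero mod_0)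

text \<open>Merging the generators one at a time with \<open>N_add\<close> costs at least
  \<open>m\<close> per merge. The bound is sharp: it is attained by \<open>N n\<close> together with
  copies of \<open>m\<close>.\<close>

lemma size_bound:
  "set_mset F \<subseteq> G \<Longrightarrow> size F * m + N (sum_mset F) \<le> sum_mset F + m"
proof (induction F)
  case empty
  then show ?case by (simp add: N_zero)
next
  case (add x F)
  then have "N (x + sum_mset F) + m \<le> x + N (sum_mset F)"
    using N_add[of x "sum_mset F"] N_gen[of x] by simp
  then show ?case using add by simp
qed

lemma multiple_of_diff:
  assumes "x mod m = y mod m" "x \<le> y"
  obtains c where "y = x + c * m"
proof -
  have "m dvd y - x" using assms by (metis mod_eq_dvd_iff_nat)
  then obtain c where "y - x = m * c" by (elim dvdE)
  then show ?thesis using that[of c] assms(2) by (simp add: mult.commute)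
qed

text \<open>The basic exchange: two generators are replaced by two others and \<open>c\<close>
  copies of \<open>m\<close>, so the length grows by exactly \<open>c\<close>.\<close>

lemma trade:
  assumes F: "add_mset g (add_mset h R) \<in> facts_of n" and c: "g + h = N u + N v + c * m"
  shows "add_mset (N u) (add_mset (N v) (replicate_mset c m + R)) \<in> facts_of n"
  using F c N_in m_in unfolding facts_of_def by auto

end

section \<open>Prime multiplicity: the walk through residues and the resulting gaps\<close>

locale med_prime = med_generators +
  fixes a D :: nat
  assumes prime_m: "prime m"
    and a_pos: "0 < a" and a_less: "a < m"
    and a_sum: "N a + N (m - a) = (D + 2) * m"
    and a_min: "\<And>b. 0 < b \<Longrightarrow> b < m \<Longrightarrow> (D + 2) * m \<le> N b + N (m - b)"
begin

lemma D_pos: "D > 0"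
proof -
  have "N a > m" "N (m - a) > m" using N_gt a_pos a_less by simp_all
  then have "2 * m < (D + 2) * m" using a_sum by linarith
  then show ?thesis by simp
qed

text \<open>Here \<open>m - a\<close> plays the role of \<open>- a\<close>. Undoing the two shifts
  by \<open>N_add\<close> costs \<open>N a + N (m - a)\<close> and gains \<open>2 * m\<close>, which
  leaves \<open>D * m\<close>.\<close>

lemma walk_step: "N r + N s \<le> N (r + a) + N (s + (m - a)) + D * m"
proof -
  have "N r = N (r + a + (m - a))" "N s = N (s + (m - a) + a)"
    using a_less by (auto intro!: N_cong)
  then have "N r + N s + 2 * m \<le> N (r + a) + N (s + (m - a)) + (N a + N (m - a))"
    using N_add[of "r + a" "m - a"] N_add[of "s + (m - a)" a] by linarith
  then show ?thesis using a_sum by (simp add: algebra_simps)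
qed

lemma walk:
  assumes "N g + N h > N (g + h) + m"
  obtains u v c where "N g + N h = N u + N v + c * m" "0 < c" "c \<le> D"
proof -
  \<comment> \<open>The two residues move in opposite directions, so their sum, and hence
    \<open>s t\<close> modulo \<open>m\<close>, stays fixed.\<close>
  define s where "s t = N (g + t * a) + N (h + t * (m - a))" for t
  have tot: "g + t * a + (h + t * (m - a)) = g + h + t * m" for t
  proof -
    have "t * a + t * (m - a) = t * m"
      using a_less by (metis add_mult_distrib2 le_add_diff_inverse less_imp_le)
    then show ?thesis by simp
  qed
  have s_mod: "s t mod m = (N g + N h) mod m" for t
  proof -
    have "s t mod m = (g + t * a + (h + t * (m - a))) mod m"
      unfolding s_def by (metis N_mod mod_add_eq)
    also have "\<dots> = (N g + N h) mod m" unfolding tot by (metis N_mod mod_add_eq mod_mult_self1)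
    finally show ?thesis .
  qed
  have cop: "coprime a m"
    using prime_m a_pos a_less
    by (metis coprime_commute nat_dvd_not_less prime_imp_coprime)
  \<comment> \<open>\<open>x\<close> inverts \<open>a\<close> modulo \<open>m\<close> and
    \<open>k = m - 1\<close> stands for -1, so \<open>t0 = g * k * x\<close> solves the congruence.
    This is where coprimality, hence primality, enters.\<close>
  obtain t0 where t0: "m dvd g + t0 * a"
  proof -
    obtain x y where xy: "a * x = m * y + 1"
      using cop a_pos bezout_nat[of a m] by auto
    define k where "k = m - 1"
    have k: "1 + k = m" using m_pos unfolding k_def by simp
    have "g + (g * k * x) * a = g + g * k * (a * x)" by (simp only: ac_simps)
    also have "\<dots> = g + g * k * (m * y + 1)" by (simp only: xy)
    also have "\<dots> = m * (g * k * y) + g * (1 + k)" by (simp add: algebra_simps)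
    also have "\<dots> = m * (g * k * y + g)" unfolding k by (simp add: algebra_simps)
    finally show ?thesis using that by (metis dvd_triv_left)
  qed
  \<comment> \<open>At \<open>t0\<close> the first residue is 0, so the value is
    \<open>m + N (g + h)\<close>, which the assumption puts below \<open>s 0\<close>.\<close>
  have "s t0 < s 0"
  proof -
    have "N (g + t0 * a) = m" using t0 N_cong[of _ 0] N_zero by simp
    moreover have "N (h + t0 * (m - a)) = N (g + h)"
    proof (rule N_cong)
      obtain q where q: "g + t0 * a = m * q" using t0 by (elim dvdE)
      then have "m * q + (h + t0 * (m - a)) = g + h + t0 * m" using tot[of t0] by simp
      then show "(h + t0 * (m - a)) mod m = (g + h) mod m"
        by (metis mod_mult_self1 mod_mult_self4)
    qed
    ultimately show ?thesis using assms by (simp add: s_def)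
  qed
  \<comment> \<open>The predecessor of the first drop still has value at least \<open>s 0\<close>,
    so a single step bounds the drop by \<open>D * m\<close>.\<close>
  define t where "t = (LEAST t. s t < s 0)"
  have t: "s t < s 0" unfolding t_def using \<open>s t0 < s 0\<close> by (rule LeastI)
  then obtain k where k: "t = Suc k" by (cases t) auto
  have "s 0 \<le> s k" using not_less_Least[of k "\<lambda>t. s t < s 0"] k unfolding t_def by force
  also have "s k \<le> s t + D * m"
    using walk_step[of "g + k * a" "h + k * (m - a)"] by (simp add: s_def k add_ac)
  finally have le: "s 0 \<le> s t + D * m" .
  obtain c where c: "s 0 = s t + c * m"
    using multiple_of_diff[of "s t" "s 0"] s_mod t by (metis less_imp_le)
  have "0 < c" "c \<le> D" using c t le m_pos by (auto intro: Nat.gr0I)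
  then show ?thesis using that[of "g + t * a" "h + t * (m - a)" c] c by (simp add: s_def)
qed

lemma lengthen:
  assumes "F \<in> facts_of n" "F' \<in> facts_of n" "size F < size F'"
  shows "\<exists>F''\<in>facts_of n. size F < size F'' \<and> size F'' \<le> size F + D"
  using assms
proof (induction "size (filter_mset (\<lambda>g. g \<noteq> m) F)" arbitrary: F rule: less_induct)
  case less
  let ?P = "filter_mset (\<lambda>g. g \<noteq> m) F"
  let ?k = "count F m"
  have split: "F = ?P + replicate_mset ?k m"
    by (metis (full_types) filter_eq_replicate_mset multiset_partition add.commute)
  show ?case
  proof (cases "size ?P \<ge> 2")
    case False
    \<comment> \<open>With at most one generator other than \<open>m\<close>, \<open>F\<close>
      attains \<open>size_bound\<close>, so no longer \<open>F'\<close> can exist.\<close>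
    have "n + m = size F * m + N n"
    proof (cases "?P = {#}")
      case True
      then have F: "F = replicate_mset ?k m" using split by (metis add_0)
      then have "n = ?k * m" "size F = ?k"
        using less.prems(1) unfolding facts_of_def by (auto, metis sum_mset_replicate_mset of_nat_id, metis size_replicate_mset)
      then show ?thesis using N_cong[of n 0] N_zero by simp
    next
      case nonempty: False
      then have "size ?P = 1" using False by (metis One_nat_def less_2_cases not_le size_eq_0_iff_empty)
      then obtain g where g: "?P = {#g#}" by (metis size_1_singleton_mset)
      then have gF: "F = add_mset g (replicate_mset ?k m)" using split by simp
      have gG: "g \<in> G" using less.prems(1) gF unfolding facts_of_def
        by (metis (mono_tags, lifting) mem_Collect_eq subset_iff union_single_eq_member)
      have "n = sum_mset F" using less.prems(1) unfolding facts_of_def by simp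
      also have "\<dots> = g + ?k * m" by (subst gF) simp
      finally have n: "n = g + ?k * m" .
      have "size F = Suc ?k" by (subst gF) simp
      moreover have "N n = g" using n N_cong[of n g] N_gen[OF gG] by simp
      ultimately show ?thesis using n by simp
    qed
    moreover have "size F' * m + N n \<le> n + m"
      using size_bound[of F'] less.prems(2) unfolding facts_of_def by simp
    ultimately have "size F' * m \<le> size F * m" by linarith
    then have False using less.prems(3) m_pos by simp
    then show ?thesis ..
  next
    case True
    then obtain g P1 where g: "?P = add_mset g P1"
      by (metis multiset_cases not_numeral_le_zero size_empty)
    then have "size P1 \<ge> 1" using True by simp
    then obtain h P2 where h: "P1 = add_mset h P2"
      by (metis multiset_cases not_one_le_zero size_empty)
    define R where "R = P2 + replicate_mset ?k m"
    have F: "F = add_mset g (add_mset h R)"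
      using split g h unfolding R_def by simp
    have "g \<in># ?P" "h \<in># ?P" using g h by auto
    then have gm: "g \<noteq> m" "h \<noteq> m" by auto
    have ghG: "g \<in> G" "h \<in> G" using less.prems(1) F unfolding facts_of_def by auto
    have le: "N (g + h) + m \<le> g + h" using N_add[of g h] ghG N_gen by simp
    show ?thesis
    proof (cases "g + h = N (g + h) + m")
      case eq: True
      \<comment> \<open>An exchange with \<open>c = 0\<close>, where \<open>N 0\<close> is
        \<open>m\<close>: the length is kept but fewer generators differ from \<open>m\<close>, so
        the induction hypothesis applies.\<close>
      let ?F = "add_mset (N (g + h)) (add_mset (N 0) R)"
      have F1: "?F \<in> facts_of n"
        using trade[of g h R n "g + h" 0 0] less.prems(1) F eq N_zero by simp
      have sz: "size ?F = size F" using F by simp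
      have less_P: "size (filter_mset (\<lambda>g. g \<noteq> m) ?F) < size ?P"
        using F gm N_zero by simp
      have "size ?F < size F'" using sz less.prems(3) by simp
      from less.hyps[OF less_P F1 less.prems(2) this] show ?thesis unfolding sz .
    next
      case False
      then have "N g + N h > N (g + h) + m" using le ghG N_gen by simp
      then obtain u v c where c: "N g + N h = N u + N v + c * m" "0 < c" "c \<le> D" using walk by blast
      have "add_mset (N u) (add_mset (N v) (replicate_mset c m + R)) \<in> facts_of n"
        using trade[of g h R n u v c] less.prems(1) F c ghG N_gen by simp
      then show ?thesis using c(2,3) F by (intro bexI) auto
    qed
  qed
qed

text \<open>If a factorization uses some \<open>g\<close> other than \<open>m\<close>, the rest has
  residue \<open>- g\<close>. Minimality of the pair sum makes \<open>size_bound\<close> so tight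
  that the rest is a single generator; otherwise only copies of \<open>m\<close> occur.\<close>

lemma sizes_of_minimal_pair:
  "size ` facts_of ((D + 2) * m) = {2, D + 2}"
proof (intro equalityI subsetI)
  fix l assume "l \<in> size ` facts_of ((D + 2) * m)"
  then obtain F where F: "set_mset F \<subseteq> G" "sum_mset F = (D + 2) * m" "l = size F"
    unfolding facts_of_def by auto
  show "l \<in> {2, D + 2}"
  proof (cases "\<exists>g\<in>#F. g \<noteq> m")
    case False
    then have "F = replicate_mset (size F) m" by (intro set_mset_subset_singletonD) auto
    then have "sum_mset F = size F * m" by (metis sum_mset_replicate_mset of_nat_id)
    then have "D + 2 = size F" using F m_pos by (metis mult_cancel2 less_not_refl)
    then show ?thesis using F by simp
  next
    case True
    then obtain g where g: "g \<in># F" "g \<noteq> m" by blast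
    then obtain R where R: "F = add_mset g R" by (metis multi_member_split)
    have gG: "g \<in> G" and RG: "set_mset R \<subseteq> G" using F R by auto
    define b where "b = g mod m"
    have b: "0 < b" "b < m" using gen_mod_zero[OF gG] g m_pos unfolding b_def by (auto intro: Nat.gr0I)
    have gb: "N b = g" using N_cong[of b g] N_gen[OF gG] by (simp add: b_def)
    have "N (sum_mset R) = N (m - b)"
    proof (rule N_cong)
      have "g + sum_mset R = (D + 2) * m" using F R by simp
      then have 0: "(b + sum_mset R) mod m = 0"
        unfolding b_def by (simp add: mod_add_left_eq)
      have "sum_mset R mod m = ((m - b) + (b + sum_mset R)) mod m" using b by simp
      also have "\<dots> = (m - b) mod m" using 0 by (metis mod_add_right_eq add_0_right)
      finally show "sum_mset R mod m = (m - b) mod m" .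
    qed
    then have "size R * m + (g + N (m - b)) \<le> (D + 2) * m + m"
      using size_bound[OF RG] F R by simp
    moreover have "(D + 2) * m \<le> g + N (m - b)" using a_min[OF b] gb by simp
    ultimately have "size R * m \<le> 1 * m" by linarith
    then have "size R \<le> 1" using m_pos by (simp only: mult_le_cancel2)
    \<comment> \<open>An empty rest would make \<open>g\<close> a multiple of
      \<open>m\<close>.\<close>
    moreover have "size R \<noteq> 0"
    proof
      assume "size R = 0"
      then have "g = (D + 2) * m" using F R by simp
      then show False using b unfolding b_def by simp
    qed
    ultimately have "size R = 1" by linarith
    then show ?thesis using F R by simp
  qed
next
  fix l assume l: "l \<in> {2, D + 2}"
  have "{#N a, N (m - a)#} \<in> facts_of ((D + 2) * m)"
    using a_sum N_in unfolding facts_of_def by simp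
  then have "2 \<in> size ` facts_of ((D + 2) * m)" by (rule image_eqI[rotated]) simp
  moreover have "replicate_mset (D + 2) m \<in> facts_of ((D + 2) * m)"
    using m_in unfolding facts_of_def by auto
  then have "D + 2 \<in> size ` facts_of ((D + 2) * m)" by (rule image_eqI[rotated]) simp
  ultimately show "l \<in> size ` facts_of ((D + 2) * m)" using l by blast
qed

lemma finite_sizes: "finite (size ` facts_of n)"
proof (rule finite_subset)
  show "size ` facts_of n \<subseteq> {..n + m}"
  proof (rule image_subsetI)
    fix F assume "F \<in> facts_of n"
    then have "size F * m \<le> n + m" using size_bound[of F] unfolding facts_of_def by simp
    moreover have "size F \<le> size F * m" using m_pos by simp
    ultimately show "size F \<in> {..n + m}" by (simp only: atMost_iff)
  qed
qed simp

end

section \<open>Gaps in sorted sets, and generators by residue class\<close>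

lemma consecutive_gap_le:
  fixes A :: "nat set"
  assumes fin: "finite A"
    and next_le: "\<And>l l'. l \<in> A \<Longrightarrow> l' \<in> A \<Longrightarrow> l < l' \<Longrightarrow> \<exists>l''\<in>A. l < l'' \<and> l'' \<le> l + D"
    and i: "Suc i < length (sorted_list_of_set A)"
  shows "sorted_list_of_set A ! Suc i - sorted_list_of_set A ! i \<le> D"
proof -
  let ?ls = "sorted_list_of_set A"
  have mem: "?ls ! k \<in> A" if "k < length ?ls" for k
    using that fin by (metis nth_mem set_sorted_list_of_set)
  have "?ls ! i < ?ls ! Suc i"
    using i strict_sorted_list_of_set[of A] by (simp add: sorted_wrt_nth_less)
  then obtain l where l: "l \<in> A" "?ls ! i < l" "l \<le> ?ls ! i + D"
    using next_le[of "?ls ! i" "?ls ! Suc i"] mem i by auto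
  then obtain k where k: "k < length ?ls" "l = ?ls ! k"
    using fin by (metis in_set_conv_nth set_sorted_list_of_set)
  \<comment> \<open>Being larger than entry \<open>i\<close>, \<open>l\<close> sits at a later
    index, so entry \<open>Suc i\<close> is at most \<open>l\<close>.\<close>
  have "i < k"
  proof (rule ccontr)
    assume "\<not> i < k"
    then have "?ls ! k \<le> ?ls ! i" using i by (intro sorted_nth_mono) auto
    then show False using l k by simp
  qed
  then have "?ls ! Suc i \<le> ?ls ! k" using k by (intro sorted_nth_mono) auto
  then show ?thesis using l k by simp
qed

text \<open>Two minimal generators in one class modulo \<open>m\<close> would differ by a multiple
  of \<open>m\<close>, making the larger reducible. So \<open>m\<close> generators occupy all
  \<open>m\<close> classes.\<close>

lemma med_generators_exists:
  assumes S: "numerical_semigroup S" and med: "max_embedding_dimension S"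
    and mult: "semigroup_multiplicity S = m" and m0: "m > 0"
  obtains N where "med_generators (min_generators S) m N"
proof -
  define G where "G = min_generators S"
  have G: "is_min_generating_set S G"
    unfolding G_def min_generators_def by (rule theI'[OF ex1_min_generating_set[OF S]])
  have fin: "finite G" and gen: "generated G = S"
    using G unfolding is_min_generating_set_def by auto
  have card: "card G = m"
    using med mult unfolding max_embedding_dimension_def embedding_dimension_def G_def by simp
  note pos = is_min_generating_set_pos[OF G]
  note irred = is_min_generating_set_irreducible[OF G]
  have GS: "g \<in> S" if "g \<in> G" for g using generated_mem[OF fin that] gen by simp
  have addS: "x + y \<in> S" if "x \<in> S" "y \<in> S" for x y using generated_add that gen by blast
  have "G \<noteq> {}" using card m0 by auto
  then obtain g0 where "g0 \<in> G" by blast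
  then have ex: "g0 \<in> S \<and> g0 > 0" using GS pos by blast
  have mS: "m \<in> S" using LeastI[of "\<lambda>n. n \<in> S \<and> n > 0", OF ex] mult
    unfolding semigroup_multiplicity_def by simp
  have m_le: "m \<le> x" if "x \<in> S" "x > 0" for x
    using Least_le[of "\<lambda>n. n \<in> S \<and> n > 0" x] that mult unfolding semigroup_multiplicity_def by simp
  have mulS: "c * m \<in> S" for c
    by (induction c) (use addS mS generated_zero gen in auto)
  have mG: "m \<in> G"
  proof -
    obtain F where F: "set_mset F \<subseteq> G" "sum_mset F = m" using mS gen generated_iff_mset[OF fin] by blast
    then have "F \<noteq> {#}" using m0 by auto
    then obtain g R where R: "F = add_mset g R" by (metis multiset_cases)
    then have "g \<in> G" "g \<le> m" using F by auto
    then show ?thesis using m_le[of g] GS pos by (metis le_antisym)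
  qed
  have no_mult: False if "g \<in> G" "x \<in> S" "x > 0" "x < g" "x mod m = g mod m" for g x
  proof -
    have "m dvd g - x" using that by (metis mod_eq_dvd_iff_nat less_imp_le)
    then obtain c where "g - x = m * c" by (elim dvdE)
    then have c: "g = x + c * m" using that(4) by (simp add: mult.commute)
    then have "c * m > 0" using that(4) by linarith
    then show False using c irred[of g x "c * m"] that mulS by blast
  qed
  have inj: "inj_on (\<lambda>g. g mod m) G"
  proof (rule inj_onI)
    fix g h assume gh: "g \<in> G" "h \<in> G" "g mod m = h mod m"
    show "g = h"
      using no_mult[of h g] no_mult[of g h] gh GS pos by (metis nat_neq_iff)
  qed
  have "(\<lambda>g. g mod m) ` G = {..<m}"
  proof (rule card_subset_eq)
    show "(\<lambda>g. g mod m) ` G \<subseteq> {..<m}" using m0 by auto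
    show "card ((\<lambda>g. g mod m) ` G) = card {..<m}" using card card_image[OF inj] by simp
  qed simp
  then have surj: "\<exists>g\<in>G. g mod m = r mod m" for r
    using m0 by (metis (no_types, lifting) imageE lessThan_iff mod_less_divisor)
  \<comment> \<open>The predicate depends only on \<open>r mod m\<close>, so \<open>N\<close>
    respects congruence by definition; injectivity makes the choice unique.\<close>
  define N where "N r = (SOME g. g \<in> G \<and> g mod m = r mod m)" for r
  have N: "N r \<in> G" "N r mod m = r mod m" for r
    using someI_ex[of "\<lambda>g. g \<in> G \<and> g mod m = r mod m"] surj[of r] unfolding N_def by blast+
  have N_gen: "N g = g" if "g \<in> G" for g
    using inj_onD[OF inj, of "N g" g] N[of g] that by simp
  have N_cong: "N r = N s" if "r mod m = s mod m" for r s using that by (simp add: N_def)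
  have N_zero: "N 0 = m" using N_cong[of 0 m] N_gen[OF mG] by simp
  have "med_generators G m N"
  proof
    \<comment> \<open>The two sums are congruent modulo \<open>m\<close>. Irreducibility excludes
      equality and \<open>no_mult\<close> the wrong order, so the difference is a positive multiple
      of \<open>m\<close>.\<close>
    show "N (r + s) + m \<le> N r + N s" for r s
    proof -
      have eq: "(N r + N s) mod m = N (r + s) mod m" by (metis N(2) mod_add_eq)
      have "N (r + s) \<noteq> N r + N s" using irred[OF N(1) GS[OF N(1)] pos[OF N(1)] GS[OF N(1)] pos[OF N(1)]] .
      moreover have "\<not> N r + N s < N (r + s)"
        using no_mult[OF N(1) addS[OF GS[OF N(1)] GS[OF N(1)]] _ _ eq] pos[OF N(1)] by auto
      ultimately have lt: "N (r + s) < N r + N s" by linarith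
      then have "m dvd N r + N s - N (r + s)" using eq by (metis mod_eq_dvd_iff_nat less_imp_le)
      then have "m \<le> N r + N s - N (r + s)" using lt by (intro dvd_imp_le) auto
      then show ?thesis using lt by simp
    qed
    show "N r > m" if "r mod m \<noteq> 0" for r
    proof -
      have "N r \<noteq> m" using N(2)[of r] that by auto
      then show ?thesis using m_le[OF GS pos, OF N(1) N(1), of r] by simp
    qed
  qed (erule N_gen N_cong | rule m0 N N_zero)+
  then show ?thesis using that unfolding G_def by blast
qed

theorem theorem4p8:
  fixes S :: "nat set" and m :: nat
  assumes "numerical_semigroup S"
    and "max_embedding_dimension S"
    and "semigroup_multiplicity S = m"
    and "m \<ge> 3"
    and "prime m"
  shows "bland S"
proof -
  define G where "G = min_generators S"
  obtain N where "med_generators G m N"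
    using med_generators_exists[OF assms(1-3)] assms(4) unfolding G_def by auto
  then interpret med_generators G m N .
  have "is_min_generating_set S G"
    unfolding G_def min_generators_def by (rule theI'[OF ex1_min_generating_set[OF assms(1)]])
  then have fin: "finite G" and gen: "generated G = S"
    unfolding is_min_generating_set_def by auto
  have ls: "length_set S n = size ` facts_of n" for n
    using length_set_iff_mset[of S _ n, folded G_def, OF fin] unfolding facts_of_def by (intro set_eqI) (simp add: image_iff, metis)
  define f where "f b = N b + N (m - b)" for b
  define a where "a = arg_min_on f {0<..<m}"
  have "1 \<in> {0<..<m}" using assms(4) by simp
  then have a: "a \<in> {0<..<m}" and a_min: "\<And>b. b \<in> {0<..<m} \<Longrightarrow> f a \<le> f b"
    using arg_min_if_finite(1)[of "{0<..<m}" f] arg_min_least[of "{0<..<m}" _ f]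
    unfolding a_def by blast+
  obtain D where D: "f a = (D + 2) * m"
  proof -
    have "f a mod m = (a + (m - a)) mod m" unfolding f_def by (metis N_mod mod_add_eq)
    then have "f a mod m = 0" using a by simp
    \<comment> \<open>The quotient exceeds 2 because both summands exceed \<open>m\<close>; this
      permits writing it as \<open>D + 2\<close> in the naturals.\<close>
    then have "m dvd f a" by (rule mod_0_imp_dvd)
    then obtain q where q: "f a = m * q" by (elim dvdE)
    have "N a > m" "N (m - a) > m" using N_gt a by simp_all
    then have "m * 2 < m * q" using q unfolding f_def by linarith
    then have "2 \<le> q" by simp
    then obtain p where "q = p + 2" by (metis le_iff_add add.commute)
    then show ?thesis using that q by (simp only: mult.commute)
  qed
  interpret med_prime G m N a D
    by unfold_locales (use assms(5) a a_min D in \<open>simp_all add: f_def\<close>)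
  let ?n = "(D + 2) * m"
  have nS: "?n \<in> S"
    using generated_add[OF generated_mem generated_mem, OF fin N_in fin N_in] a_sum gen by metis
  have ln: "length_set S ?n = {2, D + 2}" unfolding ls by (rule sizes_of_minimal_pair)
  have gap_le: "delta_set S \<subseteq> {..D}"
  proof
    fix d assume "d \<in> delta_set S"
    then obtain n i where d: "Suc i < length (sorted_list_of_set (length_set S n))"
      "d = sorted_list_of_set (length_set S n) ! Suc i - sorted_list_of_set (length_set S n) ! i"
      unfolding delta_set_def delta_set_elem_def Let_def by auto
    have "d \<le> D"
      unfolding d(2)
    proof (rule consecutive_gap_le[OF _ _ d(1)])
      show "finite (length_set S n)" unfolding ls by (rule finite_sizes)
      show "\<exists>l''\<in>length_set S n. l < l'' \<and> l'' \<le> l + D"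
        if "l \<in> length_set S n" "l' \<in> length_set S n" "l < l'" for l l'
        using that lengthen[of _ n] unfolding ls by auto
    qed
    then show "d \<in> {..D}" by simp
  qed
  \<comment> \<open>The only gap of the two-element length set is \<open>D\<close>, so the bound on
    all gaps is attained.\<close>
  have "D \<in> delta_set_elem S ?n"
  proof -
    have "sorted_list_of_set {2, D + 2} = [2, D + 2]"
      using D_pos by (simp add: sorted_list_of_set_insert)
    then show ?thesis unfolding delta_set_elem_def ln Let_def by (auto intro!: exI[of _ 0])
  qed
  then have "D \<in> delta_set S" using nS unfolding delta_set_def by blast
  then have Max: "Max (delta_set S) = D"
    using gap_le by (intro Max_eqI) (auto intro: finite_subset)
  have "length_density S \<le> length_density_elem S ?n"
    unfolding length_density_def
  proof (rule cInf_lower)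
    show "length_density_elem S ?n \<in> {length_density_elem S n |n. n \<in> S \<and> 2 \<le> card (length_set S n)}"
      using nS ln D_pos by (auto intro!: exI[of _ ?n])
    \<comment> \<open>A real infimum lies below its members only once a lower bound is known; 0
      serves, as every density is nonnegative.\<close>
    show "bdd_below {length_density_elem S n |n. n \<in> S \<and> 2 \<le> card (length_set S n)}"
    proof (rule bdd_belowI)
      fix x assume "x \<in> {length_density_elem S n |n. n \<in> S \<and> 2 \<le> card (length_set S n)}"
      then obtain n where n: "x = length_density_elem S n" "2 \<le> card (length_set S n)" by blast
      then have "length_set S n \<noteq> {}" "finite (length_set S n)"
        using card.infinite by fastforce+
      then have "Min (length_set S n) \<le> Max (length_set S n)" by simp
      then show "0 \<le> x" using n unfolding length_density_elem_def by simp
    qed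
  qed
  also have "length_density_elem S ?n = 1 / real D"
    unfolding length_density_elem_def ln using D_pos by simp
  finally show ?thesis unfolding bland_def tasty_def Max by simp
qed

end
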